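(* Let $D$ be a topological space. Then the $\infty$-globular set $\mathfrak{D}$ with $\mathfrak{D}_n=\{\pi_n(D,d):d\in D\}$ and $s(\pi_{n+1}(D,d))=t(\pi_{n+1}(D,d))=\pi_n(D,d)$, equipped with the identities $i(\pi_n(D,d))=1_{\pi_n(D,d)}:=\pi_{n+1}(D,d)$ ($n\ge 0$) and the compositions $\mathfrak{d}\circ_p\mathfrak{d}:=\{x\ast_p y : x,y\in\mathfrak{d}\}$ ($0\le p<n$, $\mathfrak{d}\in\mathfrak{D}_n$), is a strict $\infty$-groupoid.
   Context: **Higher homotopy groups.** For a topological space $D$, $d\in D$ and $n\ge 1$, a closed $n$-path at $d$ is a continuous map $\sigma:[0,1]^n\to D$ sending $\partial([0,1]^n)$ to $d$. $\pi_n(D,d)$ is the set of homotopy classes (relative to $\partial([0,1]^n)$) of closed $n$-paths at $d$. By convention here, $\pi_0(D,d):=d$. For $0\le p<n$ the operation $\ast_p$ on $\pi_n(D,d)$ is induced on classes by concatenation of closed $n$-paths in the coordinate $t_{n-p}$: $(\alpha\ast_p\beta)(t_1,\dots,t_n)$ equals $\alpha$ with $t_{n-p}$ replaced by $2t_{n-p}$ if $t_{n-p}\le\frac12$, and $\beta$ with $t_{n-p}$ replaced by $2t_{n-p}-1$ if $t_{n-p}\ge\frac12$. Elements of $\mathfrak{D}_n$ are compared by equality, not up to isomorphism: $\pi_n(D,d)=\pi_n(D,d')$ if and only if $d=d'$ (isomorphic groups at different base points are distinct elements). In particular $s,t,i$ are well defined. **$\infty$-globular set.** A sequence of sets $E_0,E_1,E_2,\dots$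 with functions $s,t:E_n\to E_{n-1}$ ($n\ge1$) such that $s(s(d))=s(t(d))$ and $t(s(d))=t(t(d))$ for all $n\ge 2$, $d\in E_n$. For $0\le p<n$ put $E_n\times_{E_p}E_n=\{(d',d)\in E_n\times E_n: t^{n-p}(d)=s^{n-p}(d')\}$. For $\mathfrak{D}$, $\mathfrak{D}_n\times_{\mathfrak{D}_p}\mathfrak{D}_n$ is the diagonal of $\mathfrak{D}_n\times\mathfrak{D}_n$, so the compositions above are defined on all composable pairs. **Strict $\infty$-groupoid.** An $\infty$-globular set $E$ with functions $\circ_p:E_n\times_{E_p}E_n\to E_n$, $(d',d)\mapsto d'\circ_p d$, for all $0\le p<n$, and $i:E_n\to E_{n+1}$, $i(d)=1_d$, for all $n\ge 0$, such that: (a) if $0\le p<n$ and $(d',d)\in E_n\times_{E_p}E_n$, then $s(d'\circ_p d)=s(d)$ and $t(d'\circ_p d)=t(d')$ when $p=n-1$, while $s(d'\circ_p d)=s(d')\circ_p s(d)$ and $t(d'\circ_p d)=t(d')\circ_p t(d)$ when $p\le n-2$; (b) $s(1_d)=d=t(1_d)$ for all $d\in E_n$; (c) $(d''\circ_p d')\circ_p d=d''\circ_p(d'\circ_p d)$ whenever $(d'',d'),(d',d)\in E_n\times_{E_p}E_n$; (d) $i^{n-p}(t^{n-p}(d))\circ_p d=d=d\circ_p i^{n-p}(s^{n-p}(d))$ for $0\le p<n$, $d\in E_n$; (e) if $0\le q<p<n$, $(e',e),(d',d)\in E_n\times_{E_p}E_n$ and $(e',d'),(e,d)\in E_n\times_{E_q}E_n$,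 then $(e'\circ_p e)\circ_q(d'\circ_p d)=(e'\circ_q d')\circ_p(e\circ_q d)$; (f) if $0\le q<p$ and $(d',d)\in E_p\times_{E_q}E_p$, then $1_{d'}\circ_q 1_d=1_{d'\circ_q d}$; (g) if $0\le p<n$ and $d\in E_n$, there is $\bar d\in E_n$ with $s(\bar d)=t(d)$, $t(\bar d)=s(d)$, $\bar d\circ_p d=i^{n-p}(s^{n-p}(d))$ and $d\circ_p\bar d=i^{n-p}(t^{n-p}(d))$. *)

theory Defs
  imports "HOL-Analysis.Analysis"
begin

section \<open>Strict infinity-groupoids\<close>

text \<open>
  The sets \<open>E 0\<close>, \<open>E 1\<close>, \<dots> of a globular set live in one type and may overlap, so all
  structure maps carry the dimension of their argument: \<open>s n\<close> and \<open>t n\<close> map \<open>E n\<close> to \<open>E (n - 1)\<close>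
  for \<open>n \<ge> 1\<close>, and \<open>idn n\<close> maps \<open>E n\<close> to \<open>E (n + 1)\<close>. Thus \<open>iter_down s n k\<close> is the iterate
  \<open>s\<^sup>k\<close> on \<open>E n\<close>, and \<open>iter_up idn n k\<close> the iterate \<open>idn\<^sup>k\<close> on \<open>E n\<close>.
\<close>

primrec iter_down :: "(nat \<Rightarrow> 'e \<Rightarrow> 'e) \<Rightarrow> nat \<Rightarrow> nat \<Rightarrow> 'e \<Rightarrow> 'e" where
  "iter_down f n 0 x = x"
| "iter_down f n (Suc k) x = iter_down f (n - 1) k (f n x)"

primrec iter_up :: "(nat \<Rightarrow> 'e \<Rightarrow> 'e) \<Rightarrow> nat \<Rightarrow> nat \<Rightarrow> 'e \<Rightarrow> 'e" where
  "iter_up f n 0 x = x"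
| "iter_up f n (Suc k) x = iter_up f (Suc n) k (f n x)"

locale globular_set =
  fixes E :: "nat \<Rightarrow> 'e set"
    and s t :: "nat \<Rightarrow> 'e \<Rightarrow> 'e"
  assumes s_closed: "\<And>n d. n \<ge> 1 \<Longrightarrow> d \<in> E n \<Longrightarrow> s n d \<in> E (n - 1)"
    and t_closed: "\<And>n d. n \<ge> 1 \<Longrightarrow> d \<in> E n \<Longrightarrow> t n d \<in> E (n - 1)"
    and ss_st: "\<And>n d. n \<ge> 2 \<Longrightarrow> d \<in> E n \<Longrightarrow> s (n - 1) (s n d) = s (n - 1) (t n d)"
    and ts_tt: "\<And>n d. n \<ge> 2 \<Longrightarrow> d \<in> E n \<Longrightarrow> t (n - 1) (s n d) = t (n - 1) (t n d)"
begin

definition composable :: "nat \<Rightarrow> nat \<Rightarrow> ('e \<times> 'e) set" where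
  "composable n p =
     {(d', d). d' \<in> E n \<and> d \<in> E n \<and> iter_down t n (n - p) d = iter_down s n (n - p) d'}"

end

text \<open>
  The term \<open>comp n p d' d\<close> is the composite of \<open>d'\<close> after \<open>d\<close> along \<open>p\<close>-cells in \<open>E n\<close>; its value
  matters only if the pair \<open>(d', d)\<close> is in \<open>composable n p\<close>. In \<open>inverses\<close>, composability
  is required explicitly because it does not follow from the equations for source and target
  unless \<open>p = n - 1\<close>; in all other axioms it is a consequence of the hypotheses and the
  remaining axioms.
\<close>

locale strict_infinity_groupoid = globular_set E s t
  for E :: "nat \<Rightarrow> 'e set" and s t :: "nat \<Rightarrow> 'e \<Rightarrow> 'e" +
  fixes comp :: "nat \<Rightarrow> nat \<Rightarrow> 'e \<Rightarrow> 'e \<Rightarrow> 'e"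
    and idn :: "nat \<Rightarrow> 'e \<Rightarrow> 'e"
  assumes comp_closed:
      "\<And>n p d' d. p < n \<Longrightarrow> (d', d) \<in> composable n p \<Longrightarrow> comp n p d' d \<in> E n"
    and idn_closed: "\<And>n d. d \<in> E n \<Longrightarrow> idn n d \<in> E (Suc n)"
    and source_target_comp_top:
      "\<And>n p d' d. p < n \<Longrightarrow> p = n - 1 \<Longrightarrow> (d', d) \<in> composable n p \<Longrightarrow>
         s n (comp n p d' d) = s n d \<and> t n (comp n p d' d) = t n d'"
    and source_target_comp_lower:
      "\<And>n p d' d. p + 2 \<le> n \<Longrightarrow> (d', d) \<in> composable n p \<Longrightarrow>
         s n (comp n p d' d) = comp (n - 1) p (s n d') (s n d) \<and>
         t n (comp n p d' d) = comp (n - 1) p (t n d') (t n d)"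
    and source_target_idn:
      "\<And>n d. d \<in> E n \<Longrightarrow> s (Suc n) (idn n d) = d \<and> t (Suc n) (idn n d) = d"
    and assoc:
      "\<And>n p d'' d' d. p < n \<Longrightarrow> (d'', d') \<in> composable n p \<Longrightarrow> (d', d) \<in> composable n p \<Longrightarrow>
         comp n p (comp n p d'' d') d = comp n p d'' (comp n p d' d)"
    and unit:
      "\<And>n p d. p < n \<Longrightarrow> d \<in> E n \<Longrightarrow>
         comp n p (iter_up idn p (n - p) (iter_down t n (n - p) d)) d = d \<and>
         comp n p d (iter_up idn p (n - p) (iter_down s n (n - p) d)) = d"
    and interchange:
      "\<And>n p q e' e d' d. q < p \<Longrightarrow> p < n \<Longrightarrow>
         (e', e) \<in> composable n p \<Longrightarrow> (d', d) \<in> composable n p \<Longrightarrow>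
         (e', d') \<in> composable n q \<Longrightarrow> (e, d) \<in> composable n q \<Longrightarrow>
         comp n q (comp n p e' e) (comp n p d' d) = comp n p (comp n q e' d') (comp n q e d)"
    and comp_idn:
      "\<And>p q d' d. q < p \<Longrightarrow> (d', d) \<in> composable p q \<Longrightarrow>
         comp (Suc p) q (idn p d') (idn p d) = idn p (comp p q d' d)"
    and inverses:
      "\<And>n p d. p < n \<Longrightarrow> d \<in> E n \<Longrightarrow>
         \<exists>d' \<in> E n. s n d' = t n d \<and> t n d' = s n d \<and>
           (d', d) \<in> composable n p \<and> (d, d') \<in> composable n p \<and>
           comp n p d' d = iter_up idn p (n - p) (iter_down s n (n - p) d) \<and>
           comp n p d d' = iter_up idn p (n - p) (iter_down t n (n - p) d)"

section \<open>Higher homotopy groups\<close>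

definition cube_topology :: "nat \<Rightarrow> (nat \<Rightarrow> real) topology" where
  "cube_topology n = product_topology (\<lambda>_. top_of_set {0..1}) {1..n}"

abbreviation cube :: "nat \<Rightarrow> (nat \<Rightarrow> real) set" where
  "cube n \<equiv> topspace (cube_topology n)"

definition cube_boundary :: "nat \<Rightarrow> (nat \<Rightarrow> real) set" where
  "cube_boundary n = {x \<in> cube n. \<exists>j \<in> {1..n}. x j = 0 \<or> x j = 1}"

text \<open>
  Maps out of the \<open>n\<close>-cube are represented by functions that are \<open>undefined\<close> outside it, so that
  equality of representatives is equality of maps on the cube.
\<close>

definition cube_maps :: "nat \<Rightarrow> 'a topology \<Rightarrow> ((nat \<Rightarrow> real) \<Rightarrow> 'a) set" where
  "cube_maps n D = {\<sigma> \<in> extensional (cube n). continuous_map (cube_topology n) D \<sigma>}"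

definition closed_paths :: "nat \<Rightarrow> 'a topology \<Rightarrow> 'a \<Rightarrow> ((nat \<Rightarrow> real) \<Rightarrow> 'a) set" where
  "closed_paths n D d = {\<sigma> \<in> cube_maps n D. \<forall>x \<in> cube_boundary n. \<sigma> x = d}"

definition homotopic_rel_boundary ::
    "nat \<Rightarrow> 'a topology \<Rightarrow> (((nat \<Rightarrow> real) \<Rightarrow> 'a) \<times> ((nat \<Rightarrow> real) \<Rightarrow> 'a)) set" where
  "homotopic_rel_boundary n D =
     {(\<sigma>, \<tau>). \<sigma> \<in> cube_maps n D \<and> \<tau> \<in> cube_maps n D \<and>
        homotopic_with (\<lambda>h. \<forall>x \<in> cube_boundary n. h x = \<sigma> x) (cube_topology n) D \<sigma> \<tau>}"

definition path_concat ::
    "nat \<Rightarrow> nat \<Rightarrow> ((nat \<Rightarrow> real) \<Rightarrow> 'a) \<Rightarrow> ((nat \<Rightarrow> real) \<Rightarrow> 'a) \<Rightarrow> (nat \<Rightarrow> real) \<Rightarrow> 'a" where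
  "path_concat n p \<alpha> \<beta> =
     (\<lambda>x \<in> cube n. if x (n - p) \<le> 1/2 then \<alpha> (x(n - p := 2 * x (n - p)))
                    else \<beta> (x(n - p := 2 * x (n - p) - 1)))"

text \<open>The operation on homotopy classes, written as in \<^theory>\<open>HOL.Equiv_Relations\<close>.\<close>

definition class_concat ::
    "'a topology \<Rightarrow> nat \<Rightarrow> nat \<Rightarrow> ((nat \<Rightarrow> real) \<Rightarrow> 'a) set \<Rightarrow> ((nat \<Rightarrow> real) \<Rightarrow> 'a) set
       \<Rightarrow> ((nat \<Rightarrow> real) \<Rightarrow> 'a) set" where
  "class_concat D n p x y =
     (\<Union>\<alpha>\<in>x. \<Union>\<beta>\<in>y. homotopic_rel_boundary n D `` {path_concat n p \<alpha> \<beta>})"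

section \<open>The globular set of homotopy groups\<close>

text \<open>A cell is a point (dimension 0) or a set of homotopy classes (positive dimension).\<close>

type_synonym 'a cell = "'a + ((nat \<Rightarrow> real) \<Rightarrow> 'a) set set"

definition homotopy_group :: "'a topology \<Rightarrow> nat \<Rightarrow> 'a \<Rightarrow> 'a cell" where
  "homotopy_group D n d =
     (if n = 0 then Inl d else Inr (closed_paths n D d // homotopic_rel_boundary n D))"

definition homotopy_cells :: "'a topology \<Rightarrow> nat \<Rightarrow> 'a cell set" where
  "homotopy_cells D n = {homotopy_group D n d | d. d \<in> topspace D}"

definition base_point :: "'a topology \<Rightarrow> nat \<Rightarrow> 'a cell \<Rightarrow> 'a" where
  "base_point D n c = (THE d. d \<in> topspace D \<and> c = homotopy_group D n d)"

definition homotopy_source :: "'a topology \<Rightarrow> nat \<Rightarrow> 'a cell \<Rightarrow> 'a cell" where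
  "homotopy_source D n c = homotopy_group D (n - 1) (base_point D n c)"

definition homotopy_target :: "'a topology \<Rightarrow> nat \<Rightarrow> 'a cell \<Rightarrow> 'a cell" where
  "homotopy_target D n c = homotopy_group D (n - 1) (base_point D n c)"

definition homotopy_idn :: "'a topology \<Rightarrow> nat \<Rightarrow> 'a cell \<Rightarrow> 'a cell" where
  "homotopy_idn D n c = homotopy_group D (Suc n) (base_point D n c)"

text \<open>Composable pairs lie on the diagonal, so only the case \<open>G' = G\<close> is relevant.\<close>

fun homotopy_comp :: "'a topology \<Rightarrow> nat \<Rightarrow> nat \<Rightarrow> 'a cell \<Rightarrow> 'a cell \<Rightarrow> 'a cell" where
  "homotopy_comp D n p (Inr G') (Inr G) = Inr {class_concat D n p x y | x y. x \<in> G' \<and> y \<in> G}"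
| "homotopy_comp D n p _ _ = undefined"

end

theory Submission
  imports Defs
begin

text \<open>
  Homotopy groups at distinct base points are distinct sets, because their elements have
  different boundary values. Hence every composable pair lies on the diagonal. The class of the
  constant map is a right unit for each concatenation, so \<open>{x \<^bold>* y | x y \<in> G} = G\<close> for every homotopy
  group \<open>G\<close>; thus all compositions are the identity on the diagonal and the axioms become trivial.
\<close>

section \<open>Closed paths and homotopy relative to the boundary\<close>

lemma topspace_cube: "cube n = PiE {1..n} (\<lambda>_. {0..1})"
  by (simp add: cube_topology_def)

lemma continuous_map_cube_coordinate:
  assumes "j \<in> {1..n}"
  shows "continuous_map (cube_topology n) (top_of_set {0..1}) (\<lambda>x. x j)"
  unfolding cube_topology_def using assms by (rule continuous_map_product_projection)

text \<open>Continuity into the product is checked coordinatewise: coordinate \<open>j\<close> is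
  \<open>f\<close>, every other one is a projection of \<open>g\<close>. All reparametrisations in
  the homotopies below have this form.\<close>

lemma continuous_map_cube_update:
  assumes g: "continuous_map X (cube_topology n) g"
    and f: "continuous_map X (top_of_set {0..1}) f" and j: "j \<in> {1..n}"
  shows "continuous_map X (cube_topology n) (\<lambda>z. (g z)(j := f z))"
proof -
  have ext: "g z \<in> extensional {1..n}" if "z \<in> topspace X" for z
    using continuous_map_image_subset_topspace[OF g] that by (auto simp: topspace_cube PiE_def)
  have "continuous_map X (top_of_set {0..1}) (\<lambda>z. ((g z)(j := f z)) k)" if "k \<in> {1..n}" for k
  proof (cases "k = j")
    case True
    then show ?thesis using f by simp
  next
    case False
    then show ?thesis
      using continuous_map_compose[OF g continuous_map_cube_coordinate[OF that]] by (simp add: o_def)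
  qed
  then show ?thesis
    using ext j unfolding cube_topology_def continuous_map_componentwise
    by (auto simp: extensional_def)
qed

lemma cube_update:
  assumes "x \<in> cube n" "j \<in> {1..n}" "c \<in> {0..1}"
  shows "x(j := c) \<in> cube n"
  using assms by (auto simp: topspace_cube PiE_iff extensional_def)

lemma cube_coordinate:
  assumes "x \<in> cube n" "j \<in> {1..n}"
  shows "0 \<le> x j" "x j \<le> 1"
  using assms by (auto simp: topspace_cube PiE_iff)

text \<open>A boundary witness other than \<open>j\<close> survives the update. The last assumption
  covers the case where \<open>j\<close> itself is the witness.\<close>

lemma cube_boundary_update:
  assumes "x \<in> cube_boundary n" "j \<in> {1..n}" "c \<in> {0..1}" "x j = 0 \<or> x j = 1 \<Longrightarrow> c = 0 \<or> c = 1"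
  shows "x(j := c) \<in> cube_boundary n"
  using assms cube_update unfolding cube_boundary_def by fastforce

lemma cube_boundaryI:
  assumes "x \<in> cube n" "j \<in> {1..n}" "x j = 0 \<or> x j = 1"
  shows "x \<in> cube_boundary n"
  using assms by (auto simp: cube_boundary_def)

text \<open>The side condition of the homotopy mentions only the first map, so symmetry and
  transitivity rest on the fact that homotopic maps have the same boundary values: one condition can
  then be exchanged for the other.\<close>

lemma equiv_homotopic_rel_boundary: "equiv (cube_maps n D) (homotopic_rel_boundary n D)"
proof (rule equivI)
  show "homotopic_rel_boundary n D \<subseteq> cube_maps n D \<times> cube_maps n D"
    by (auto simp: homotopic_rel_boundary_def)
  show "refl_on (cube_maps n D) (homotopic_rel_boundary n D)"
    by (auto simp: refl_on_def homotopic_rel_boundary_def cube_maps_def)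
  show "sym (homotopic_rel_boundary n D)"
  proof (rule symI)
    fix \<sigma> \<tau> assume "(\<sigma>, \<tau>) \<in> homotopic_rel_boundary n D"
    then have maps: "\<sigma> \<in> cube_maps n D" "\<tau> \<in> cube_maps n D"
      and h: "homotopic_with (\<lambda>h. \<forall>x \<in> cube_boundary n. h x = \<sigma> x) (cube_topology n) D \<sigma> \<tau>"
      by (auto simp: homotopic_rel_boundary_def)
    have "\<forall>x \<in> cube_boundary n. \<tau> x = \<sigma> x"
      using homotopic_with_imp_property[OF h] by blast
    then have "homotopic_with (\<lambda>h. \<forall>x \<in> cube_boundary n. h x = \<tau> x) (cube_topology n) D \<tau> \<sigma>"
      using homotopic_with_symD[OF h] by (rule_tac homotopic_with_mono) auto
    with maps show "(\<tau>, \<sigma>) \<in> homotopic_rel_boundary n D"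
      by (simp add: homotopic_rel_boundary_def)
  qed
  show "trans (homotopic_rel_boundary n D)"
  proof (rule transI)
    fix \<sigma> \<tau> \<upsilon>
    assume "(\<sigma>, \<tau>) \<in> homotopic_rel_boundary n D" "(\<tau>, \<upsilon>) \<in> homotopic_rel_boundary n D"
    then have maps: "\<sigma> \<in> cube_maps n D" "\<upsilon> \<in> cube_maps n D"
      and h: "homotopic_with (\<lambda>h. \<forall>x \<in> cube_boundary n. h x = \<sigma> x) (cube_topology n) D \<sigma> \<tau>"
      and k: "homotopic_with (\<lambda>h. \<forall>x \<in> cube_boundary n. h x = \<tau> x) (cube_topology n) D \<tau> \<upsilon>"
      by (auto simp: homotopic_rel_boundary_def)
    have "\<forall>x \<in> cube_boundary n. \<tau> x = \<sigma> x"
      using homotopic_with_imp_property[OF h] by blast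
    then have "homotopic_with (\<lambda>h. \<forall>x \<in> cube_boundary n. h x = \<sigma> x) (cube_topology n) D \<tau> \<upsilon>"
      using k by (rule_tac homotopic_with_mono) auto
    from homotopic_with_trans[OF h this] maps show "(\<sigma>, \<upsilon>) \<in> homotopic_rel_boundary n D"
      by (simp add: homotopic_rel_boundary_def)
  qed
qed

lemma homotopic_rel_boundary_closed_paths:
  assumes "\<sigma> \<in> closed_paths n D d" "(\<sigma>, \<tau>) \<in> homotopic_rel_boundary n D"
  shows "\<tau> \<in> closed_paths n D d"
proof -
  have "\<tau> \<in> cube_maps n D" "\<forall>x \<in> cube_boundary n. \<tau> x = \<sigma> x"
    using assms(2) by (auto simp: homotopic_rel_boundary_def dest: homotopic_with_imp_property)
  with assms(1) show ?thesis
    by (simp add: closed_paths_def)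
qed

lemma homotopic_rel_boundary_refl:
  "\<sigma> \<in> closed_paths n D d \<Longrightarrow> (\<sigma>, \<sigma>) \<in> homotopic_rel_boundary n D"
  using equiv_homotopic_rel_boundary[of n D]
  by (auto simp: closed_paths_def equiv_def refl_on_def)

lemma constant_closed_path:
  "d \<in> topspace D \<Longrightarrow> (\<lambda>x \<in> cube n. d) \<in> closed_paths n D d"
  by (auto simp: closed_paths_def cube_maps_def cube_boundary_def
      intro: continuous_map_eq[of _ _ "\<lambda>_. d"])

text \<open>Introduction rule for homotopies given by a formula. The ends need to match only on the
  cube, since the formula may take arbitrary values outside, whereas representatives are
  extensional.\<close>

lemma homotopic_rel_boundaryI:
  fixes h :: "real \<Rightarrow> (nat \<Rightarrow> real) \<Rightarrow> 'a"
  assumes cont: "continuous_map (prod_topology (top_of_set {0..1}) (cube_topology n)) D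
      (\<lambda>z. h (fst z) (snd z))"
    and boundary: "\<And>t x. t \<in> {0..1} \<Longrightarrow> x \<in> cube_boundary n \<Longrightarrow> h t x = d"
    and ext: "\<sigma> \<in> extensional (cube n)" "\<tau> \<in> extensional (cube n)"
    and ends: "\<And>x. x \<in> cube n \<Longrightarrow> \<sigma> x = h 0 x" "\<And>x. x \<in> cube n \<Longrightarrow> \<tau> x = h 1 x"
  shows "(\<sigma>, \<tau>) \<in> homotopic_rel_boundary n D" "\<sigma> \<in> closed_paths n D d"
proof -
  have sub: "x \<in> cube n" if "x \<in> cube_boundary n" for x
    using that by (simp add: cube_boundary_def)
  let ?P = "\<lambda>g. \<forall>x \<in> cube_boundary n. g x = d"
  have "homotopic_with ?P (cube_topology n) D (h 0) (h 1)"
    unfolding homotopic_with_def using cont boundary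
    by (intro exI[of _ "\<lambda>z. h (fst z) (snd z)"]) auto
  \<comment> \<open>The ends may be replaced by maps equal to them on the cube, because
    \<open>?P\<close> looks only at boundary points.\<close>
  then have hom: "homotopic_with ?P (cube_topology n) D \<sigma> \<tau>"
    by (rule homotopic_with_eq) (use ends sub in auto)
  have \<sigma>: "\<forall>x \<in> cube_boundary n. \<sigma> x = d"
    using homotopic_with_imp_property[OF hom] by blast
  have maps: "\<sigma> \<in> cube_maps n D" "\<tau> \<in> cube_maps n D"
    using homotopic_with_imp_continuous_maps[OF hom] ext by (auto simp: cube_maps_def)
  have "homotopic_with (\<lambda>g. \<forall>x \<in> cube_boundary n. g x = \<sigma> x) (cube_topology n) D \<sigma> \<tau>"
    using hom \<sigma> by (rule_tac homotopic_with_mono) auto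
  with maps show "(\<sigma>, \<tau>) \<in> homotopic_rel_boundary n D"
    by (simp add: homotopic_rel_boundary_def)
  show "\<sigma> \<in> closed_paths n D d"
    using maps \<sigma> by (simp add: closed_paths_def)
qed

lemma homotopic_rel_boundaryE:
  assumes "(\<sigma>, \<tau>) \<in> homotopic_rel_boundary n D" "\<sigma> \<in> closed_paths n D d"
  obtains h :: "real \<Rightarrow> (nat \<Rightarrow> real) \<Rightarrow> 'a"
  where "continuous_map (prod_topology (top_of_set {0..1}) (cube_topology n)) D
      (\<lambda>z. h (fst z) (snd z))"
    and "\<And>t x. t \<in> {0..1} \<Longrightarrow> x \<in> cube_boundary n \<Longrightarrow> h t x = d"
    and "h 0 = \<sigma>" "h 1 = \<tau>"
proof -
  have "homotopic_with (\<lambda>h. \<forall>x \<in> cube_boundary n. h x = \<sigma> x) (cube_topology n) D \<sigma> \<tau>"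
    using assms(1) by (simp add: homotopic_rel_boundary_def)
  then obtain h :: "real \<times> (nat \<Rightarrow> real) \<Rightarrow> 'a"
    where h: "continuous_map (prod_topology (top_of_set {0..1}) (cube_topology n)) D h"
    "\<forall>x. h (0, x) = \<sigma> x" "\<forall>x. h (1, x) = \<tau> x"
    "\<forall>t \<in> {0..1}. \<forall>x \<in> cube_boundary n. h (t, x) = \<sigma> x"
    unfolding homotopic_with_def by blast
  show thesis
  proof (rule that[of "curry h"])
    show "curry h t x = d" if "t \<in> {0..1}" "x \<in> cube_boundary n" for t x
      using h(4) assms(2) that by (simp add: closed_paths_def)
  qed (use h in auto)
qed

section \<open>Concatenation\<close>

lemma continuous_map_unit_interval:
  assumes "continuous_map X euclideanreal f" "\<And>z. z \<in> topspace X \<Longrightarrow> f z \<in> {0..1}"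
  shows "continuous_map X (top_of_set {0..1}) f"
  using assms by (auto simp: continuous_map_in_subtopology)

lemma path_concat_extensional: "path_concat n p \<alpha> \<beta> \<in> extensional (cube n)"
  unfolding path_concat_def by (rule restrict_extensional)

text \<open>The two given homotopies are concatenated at each time. They fit together along the
  middle hyperplane because both have the value \<open>d\<close> on the boundary of the
  cube.\<close>

lemma path_concat_homotopic:
  assumes "p < n"
    and \<alpha>: "\<alpha> \<in> closed_paths n D d" "(\<alpha>, \<alpha>') \<in> homotopic_rel_boundary n D"
    and \<beta>: "\<beta> \<in> closed_paths n D d" "(\<beta>, \<beta>') \<in> homotopic_rel_boundary n D"
  shows "(path_concat n p \<alpha> \<beta>, path_concat n p \<alpha>' \<beta>') \<in> homotopic_rel_boundary n D"
    and "path_concat n p \<alpha> \<beta> \<in> closed_paths n D d"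
proof -
  define j where "j = n - p"
  have j: "j \<in> {1..n}" using assms(1) by (auto simp: j_def)
  let ?X = "prod_topology (top_of_set {0..1::real}) (cube_topology n)"
  obtain a where a: "continuous_map ?X D (\<lambda>z. a (fst z) (snd z))"
    "\<And>t x. t \<in> {0..1} \<Longrightarrow> x \<in> cube_boundary n \<Longrightarrow> a t x = d" "a 0 = \<alpha>" "a 1 = \<alpha>'"
    using homotopic_rel_boundaryE[OF \<alpha>(2,1)] by blast
  obtain b where b: "continuous_map ?X D (\<lambda>z. b (fst z) (snd z))"
    "\<And>t x. t \<in> {0..1} \<Longrightarrow> x \<in> cube_boundary n \<Longrightarrow> b t x = d" "b 0 = \<beta>" "b 1 = \<beta>'"
    using homotopic_rel_boundaryE[OF \<beta>(2,1)] by blast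
  \<comment> \<open>Truncating with \<open>min\<close> and \<open>max\<close> keeps both branches inside the cube, hence globally continuous.\<close>
  define l where "l = (\<lambda>x::nat \<Rightarrow> real. x(j := min 1 (2 * x j)))"
  define r where "r = (\<lambda>x::nat \<Rightarrow> real. x(j := max 0 (2 * x j - 1)))"
  define h where "h = (\<lambda>t x. if x j \<le> 1/2 then a t (l x) else b t (r x))"
  have snd: "continuous_map ?X (cube_topology n) snd"
    by (rule continuous_map_snd)
  have "continuous_map ?X (top_of_set {0..1}) (\<lambda>z. snd z j)"
    using continuous_map_compose[OF snd continuous_map_cube_coordinate[OF j]] by (simp add: o_def)
  then have coord: "continuous_map ?X euclideanreal (\<lambda>z. snd z j)"
    by (simp add: continuous_map_in_subtopology)
  have l: "continuous_map ?X (cube_topology n) (\<lambda>z. l (snd z))"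
    unfolding l_def
    by (intro continuous_map_cube_update snd j continuous_map_unit_interval
        continuous_map_real_min continuous_map_real_mult coord)
      (auto dest: cube_coordinate[OF _ j])
  have r: "continuous_map ?X (cube_topology n) (\<lambda>z. r (snd z))"
    unfolding r_def
    by (intro continuous_map_cube_update snd j continuous_map_unit_interval
        continuous_map_real_max continuous_map_real_mult continuous_map_diff coord)
      (auto dest: cube_coordinate[OF _ j])
  have pair: "continuous_map ?X ?X (\<lambda>z. (fst z, f (snd z)))"
    if "continuous_map ?X (cube_topology n) (\<lambda>z. f (snd z))" for f
    using that by (simp add: continuous_map_pairwise o_def continuous_map_fst)
  have al: "continuous_map ?X D (\<lambda>z. a (fst z) (l (snd z)))"
    using continuous_map_compose[OF pair[OF l] a(1)] by (simp add: o_def)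
  have br: "continuous_map ?X D (\<lambda>z. b (fst z) (r (snd z)))"
    using continuous_map_compose[OF pair[OF r] b(1)] by (simp add: o_def)
  \<comment> \<open>Truncation pins coordinate \<open>j\<close> of \<open>l x\<close> to 1 from the
    middle onwards, and that of \<open>r x\<close> to 0 up to the middle. On the hyperplane
    \<open>x j = 1/2\<close> both points are therefore boundary points.\<close>
  have lb: "l x \<in> cube_boundary n" if "x \<in> cube n" "x j = 0 \<or> 1/2 \<le> x j" for x
    by (rule cube_boundaryI[OF _ j])
      (use that cube_coordinate[OF that(1) j] in \<open>auto simp: l_def intro!: cube_update j\<close>)
  have rb: "r x \<in> cube_boundary n" if "x \<in> cube n" "x j \<le> 1/2 \<or> x j = 1" for x
    by (rule cube_boundaryI[OF _ j])
      (use that cube_coordinate[OF that(1) j] in \<open>auto simp: r_def intro!: cube_update j\<close>)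
  have cont: "continuous_map ?X D (\<lambda>z. h (fst z) (snd z))"
    unfolding h_def
  proof (rule continuous_map_cases_le)
    fix z assume z: "z \<in> topspace ?X" "snd z j = 1/2"
    then have "l (snd z) \<in> cube_boundary n" "r (snd z) \<in> cube_boundary n" "fst z \<in> {0..1}"
      by (auto intro: lb rb)
    then show "a (fst z) (l (snd z)) = b (fst z) (r (snd z))"
      by (simp add: a(2) b(2))
  qed (auto intro: continuous_map_from_subtopology coord al br)
  \<comment> \<open>Both truncated reparametrisations fix the end points 0 and 1 of coordinate
    \<open>j\<close>, so either branch of \<open>h\<close> is evaluated at a boundary point.\<close>
  have boundary: "h t x = d" if t: "t \<in> {0..1}" and x: "x \<in> cube_boundary n" for t x
  proof -
    have xc: "x \<in> cube n" using x by (simp add: cube_boundary_def)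
    have "l x \<in> cube_boundary n" "r x \<in> cube_boundary n"
      using cube_coordinate[OF xc j] unfolding l_def r_def
      by (auto intro!: cube_boundary_update[OF x j])
    then show ?thesis
      using a(2) b(2) t by (simp add: h_def)
  qed
  \<comment> \<open>On the half of the cube where each branch is used, its truncation has no
    effect.\<close>
  have eq: "path_concat n p \<gamma> \<delta> x = (if x j \<le> 1/2 then \<gamma> (l x) else \<delta> (r x))"
    if "x \<in> cube n" for x and \<gamma> \<delta> :: "(nat \<Rightarrow> real) \<Rightarrow> 'a"
    using that by (auto simp: path_concat_def l_def r_def min_absorb2 max_absorb2 simp flip: j_def)
  have ends: "path_concat n p \<alpha> \<beta> x = h 0 x" "path_concat n p \<alpha>' \<beta>' x = h 1 x" if "x \<in> cube n" for x
    using that by (simp_all add: eq h_def a b)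
  show "(path_concat n p \<alpha> \<beta>, path_concat n p \<alpha>' \<beta>') \<in> homotopic_rel_boundary n D"
    "path_concat n p \<alpha> \<beta> \<in> closed_paths n D d"
    using homotopic_rel_boundaryI[OF cont boundary path_concat_extensional path_concat_extensional ends] by auto
qed

text \<open>At time \<open>t\<close> the homotopy runs through \<open>\<alpha>\<close> at speed
  \<open>1 + t\<close> in coordinate \<open>j\<close> and then rests on the face where that
  coordinate is 1, where \<open>\<alpha>\<close> equals \<open>d\<close>.\<close>

lemma path_concat_constant_right:
  assumes "p < n" and \<alpha>: "\<alpha> \<in> closed_paths n D d"
  shows "(\<alpha>, path_concat n p \<alpha> (\<lambda>x \<in> cube n. d)) \<in> homotopic_rel_boundary n D"
proof -
  define j where "j = n - p"
  have j: "j \<in> {1..n}" using assms(1) by (auto simp: j_def)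
  have \<alpha>_cont: "continuous_map (cube_topology n) D \<alpha>" and \<alpha>_ext: "\<alpha> \<in> extensional (cube n)"
    and \<alpha>_boundary: "\<And>x. x \<in> cube_boundary n \<Longrightarrow> \<alpha> x = d"
    using \<alpha> by (auto simp: closed_paths_def cube_maps_def)
  let ?X = "prod_topology (top_of_set {0..1::real}) (cube_topology n)"
  \<comment> \<open>On the cube, \<open>u 0\<close> is the identity and \<open>u 1\<close> doubles
    coordinate \<open>j\<close>, cut off at 1.\<close>
  define u where "u = (\<lambda>t (x::nat \<Rightarrow> real). x(j := min 1 ((1 + t) * x j)))"
  have snd: "continuous_map ?X (cube_topology n) snd"
    by (rule continuous_map_snd)
  have "continuous_map ?X (top_of_set {0..1}) (\<lambda>z. snd z j)"
    using continuous_map_compose[OF snd continuous_map_cube_coordinate[OF j]] by (simp add: o_def)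
  then have coord: "continuous_map ?X euclideanreal (\<lambda>z. snd z j)"
    by (simp add: continuous_map_in_subtopology)
  have "continuous_map ?X (top_of_set {0..1}) fst"
    by (rule continuous_map_fst)
  then have fst: "continuous_map ?X euclideanreal fst"
    by (simp add: continuous_map_in_subtopology)
  have "continuous_map ?X (cube_topology n) (\<lambda>z. u (fst z) (snd z))"
    unfolding u_def
    by (intro continuous_map_cube_update snd j continuous_map_unit_interval
        continuous_map_real_min continuous_map_real_mult continuous_map_add coord fst)
      (auto dest: cube_coordinate[OF _ j])
  from continuous_map_compose[OF this \<alpha>_cont]
  have cont: "continuous_map ?X D (\<lambda>z. \<alpha> (u (fst z) (snd z)))"
    by (simp add: o_def)
  have boundary: "\<alpha> (u t x) = d" if t: "t \<in> {0..1}" and x: "x \<in> cube_boundary n" for t x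
  proof -
    have "x \<in> cube n" using x by (simp add: cube_boundary_def)
    then have "u t x \<in> cube_boundary n"
      using cube_coordinate[of x n j] j t unfolding u_def
      by (auto intro!: cube_boundary_update[OF x j])
    then show ?thesis by (rule \<alpha>_boundary)
  qed
  have start: "\<alpha> x = \<alpha> (u 0 x)" if "x \<in> cube n" for x
    using cube_coordinate[OF that j] by (simp add: u_def min_absorb2)
  have final: "path_concat n p \<alpha> (\<lambda>x \<in> cube n. d) x = \<alpha> (u 1 x)" if x: "x \<in> cube n" for x
  proof (cases "x j \<le> 1/2")
    case True
    then show ?thesis using x by (simp add: path_concat_def u_def min_absorb2 flip: j_def)
  next
    case False
    \<comment> \<open>The constant path is \<open>undefined\<close> off the cube, so its argument
      has to be shown to lie inside.\<close>
    have c: "x(j := 2 * x j - 1) \<in> cube n"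
      using False cube_coordinate[OF x j] by (intro cube_update[OF x j]) auto
    have "u 1 x \<in> cube_boundary n"
      using False by (intro cube_boundaryI[OF _ j]) (auto simp: u_def intro!: cube_update[OF x j])
    with False c x show ?thesis
      by (simp add: path_concat_def \<alpha>_boundary flip: j_def)
  qed
  show ?thesis
    by (rule homotopic_rel_boundaryI(1)[of n D "\<lambda>t x. \<alpha> (u t x)", OF cont boundary \<alpha>_ext
          path_concat_extensional start final])
qed

text \<open>The union defining \<open>class_concat\<close> runs over all representatives. By
  \<open>path_concat_homotopic\<close> every member is the same class, and reflexivity supplies the
  given representatives, so the union is that class.\<close>

lemma class_concat_eq:
  assumes "p < n" and \<alpha>: "\<alpha> \<in> closed_paths n D d" and \<beta>: "\<beta> \<in> closed_paths n D d"
  shows "class_concat D n p (homotopic_rel_boundary n D `` {\<alpha>}) (homotopic_rel_boundary n D `` {\<beta>})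
    = homotopic_rel_boundary n D `` {path_concat n p \<alpha> \<beta>}"
proof -
  have "homotopic_rel_boundary n D `` {path_concat n p \<alpha>' \<beta>'}
      = homotopic_rel_boundary n D `` {path_concat n p \<alpha> \<beta>}"
    if "(\<alpha>, \<alpha>') \<in> homotopic_rel_boundary n D" "(\<beta>, \<beta>') \<in> homotopic_rel_boundary n D" for \<alpha>' \<beta>'
    using equiv_class_eq[OF equiv_homotopic_rel_boundary
        path_concat_homotopic(1)[OF assms(1) \<alpha> that(1) \<beta> that(2)]] by simp
  then show ?thesis
    using homotopic_rel_boundary_refl[OF \<alpha>] homotopic_rel_boundary_refl[OF \<beta>]
    unfolding class_concat_def by blast
qed

section \<open>The globular set of homotopy groups\<close>

text \<open>Products of classes stay in the group since concatenations are closed paths at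
  \<open>d\<close>. Conversely, each class is its own product with the class of the constant
  path.\<close>

lemma homotopy_comp_diagonal:
  assumes "p < n" and d: "d \<in> topspace D"
  shows "homotopy_comp D n p (homotopy_group D n d) (homotopy_group D n d) = homotopy_group D n d"
proof -
  let ?R = "homotopic_rel_boundary n D"
  let ?G = "closed_paths n D d // ?R"
  have "{class_concat D n p x y | x y. x \<in> ?G \<and> y \<in> ?G} = ?G"
  proof (intro equalityI subsetI)
    fix z assume "z \<in> {class_concat D n p x y | x y. x \<in> ?G \<and> y \<in> ?G}"
    then obtain \<alpha> \<beta> where \<alpha>: "\<alpha> \<in> closed_paths n D d" and \<beta>: "\<beta> \<in> closed_paths n D d"
      and z: "z = class_concat D n p (?R `` {\<alpha>}) (?R `` {\<beta>})"
      by (auto elim!: quotientE)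
    show "z \<in> ?G"
      unfolding z class_concat_eq[OF assms(1) \<alpha> \<beta>]
      by (rule quotientI, rule path_concat_homotopic(2)[OF assms(1)
            \<alpha> homotopic_rel_boundary_refl[OF \<alpha>] \<beta> homotopic_rel_boundary_refl[OF \<beta>]])
  next
    fix z assume "z \<in> ?G"
    then obtain \<alpha> where \<alpha>: "\<alpha> \<in> closed_paths n D d" and z: "z = ?R `` {\<alpha>}"
      by (auto elim!: quotientE)
    let ?c = "\<lambda>x \<in> cube n. d"
    have c: "?c \<in> closed_paths n D d"
      using d by (rule constant_closed_path)
    have "z = class_concat D n p (?R `` {\<alpha>}) (?R `` {?c})"
      unfolding z class_concat_eq[OF assms(1) \<alpha> c]
      by (rule equiv_class_eq[OF equiv_homotopic_rel_boundary path_concat_constant_right[OF assms(1) \<alpha>]])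
    with \<alpha> c show "z \<in> {class_concat D n p x y | x y. x \<in> ?G \<and> y \<in> ?G}"
      by (blast intro: quotientI)
  qed
  \<comment> \<open>From \<open>p < n\<close> the dimension is positive, so the cell is an
    \<open>Inr\<close> and the first equation of \<open>homotopy_comp\<close> applies.\<close>
  with assms(1) show ?thesis
    by (simp add: homotopy_group_def)
qed

text \<open>In positive dimension the class of the constant path at \<open>d\<close> belongs to both
  groups, so this path is also closed at \<open>d'\<close>. Evaluating it at a boundary point
  identifies the base points.\<close>

lemma homotopy_group_inj:
  assumes d: "d \<in> topspace D" and eq: "homotopy_group D n d = homotopy_group D n d'"
  shows "d = d'"
proof (cases "n = 0")
  case True
  with eq show ?thesis by (simp add: homotopy_group_def)
next
  case False
  let ?R = "homotopic_rel_boundary n D" and ?c = "\<lambda>x \<in> cube n. d"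
  have c: "?c \<in> closed_paths n D d"
    using d by (rule constant_closed_path)
  then have "?R `` {?c} \<in> closed_paths n D d' // ?R"
    using eq False by (auto simp: homotopy_group_def intro: quotientI)
  then obtain \<sigma> where \<sigma>: "\<sigma> \<in> closed_paths n D d'" "?R `` {?c} = ?R `` {\<sigma>}"
    by (auto elim!: quotientE)
  then have "(\<sigma>, ?c) \<in> ?R"
    using homotopic_rel_boundary_refl[OF c] by blast
  with \<sigma>(1) have c': "?c \<in> closed_paths n D d'"
    by (rule homotopic_rel_boundary_closed_paths)
  \<comment> \<open>The origin is a boundary point because a coordinate 1 exists when
    \<open>n\<close> is nonzero.\<close>
  define x where "x = (\<lambda>i \<in> {1..n}. 0::real)"
  have "x \<in> cube_boundary n"
    using False by (auto simp: x_def topspace_cube intro!: cube_boundaryI[of _ _ 1])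
  with c c' show ?thesis
    by (auto simp: closed_paths_def)
qed

text \<open>Injectivity makes the description in \<open>base_point\<close> unique, so the structure
  maps can be computed from base points.\<close>

lemma base_point_homotopy_group:
  assumes "d \<in> topspace D"
  shows "base_point D n (homotopy_group D n d) = d"
  unfolding base_point_def
  by (rule the_equality) (use assms in \<open>auto dest: homotopy_group_inj\<close>)

lemma homotopy_source_homotopy_group:
  "d \<in> topspace D \<Longrightarrow> homotopy_source D n (homotopy_group D n d) = homotopy_group D (n - 1) d"
  by (simp add: homotopy_source_def base_point_homotopy_group)

lemma homotopy_target_homotopy_group:
  "d \<in> topspace D \<Longrightarrow> homotopy_target D n (homotopy_group D n d) = homotopy_group D (n - 1) d"
  by (simp add: homotopy_target_def base_point_homotopy_group)

lemma homotopy_idn_homotopy_group: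
  "d \<in> topspace D \<Longrightarrow> homotopy_idn D n (homotopy_group D n d) = homotopy_group D (Suc n) d"
  by (simp add: homotopy_idn_def base_point_homotopy_group)

text \<open>No bound on \<open>k\<close> is required: with truncated subtraction, the source map in
  dimension 0 fixes each point.\<close>

lemma iter_down_homotopy_source:
  "d \<in> topspace D \<Longrightarrow>
    iter_down (homotopy_source D) n k (homotopy_group D n d) = homotopy_group D (n - k) d"
  by (induction k arbitrary: n) (simp_all add: homotopy_source_homotopy_group)

lemma iter_down_homotopy_target:
  "d \<in> topspace D \<Longrightarrow>
    iter_down (homotopy_target D) n k (homotopy_group D n d) = homotopy_group D (n - k) d"
  by (induction k arbitrary: n) (simp_all add: homotopy_target_homotopy_group)

lemma iter_up_homotopy_idn:
  "d \<in> topspace D \<Longrightarrow>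
    iter_up (homotopy_idn D) n k (homotopy_group D n d) = homotopy_group D (n + k) d"
  by (induction k arbitrary: n) (simp_all add: homotopy_idn_homotopy_group)

lemma homotopy_group_in_cells: "d \<in> topspace D \<Longrightarrow> homotopy_group D n d \<in> homotopy_cells D n"
  by (auto simp: homotopy_cells_def)

lemma homotopy_cellsE:
  assumes "c \<in> homotopy_cells D n"
  obtains d where "d \<in> topspace D" "c = homotopy_group D n d"
  using assms by (auto simp: homotopy_cells_def)

lemmas homotopy_group_simps =
  homotopy_source_homotopy_group homotopy_target_homotopy_group homotopy_idn_homotopy_group
  iter_down_homotopy_source iter_down_homotopy_target iter_up_homotopy_idn
  homotopy_group_in_cells homotopy_comp_diagonal

lemma globular_set_homotopy_cells:
  "globular_set (homotopy_cells D) (homotopy_source D) (homotopy_target D)"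
  by unfold_locales (auto elim!: homotopy_cellsE simp: homotopy_group_simps)

text \<open>Iterated sources and targets keep the base point, and groups of the same dimension agree
  only if their base points do.\<close>

lemma composable_homotopy_cells:
  "(c', c) \<in> globular_set.composable (homotopy_cells D) (homotopy_source D) (homotopy_target D) n p \<longleftrightarrow>
    c' = c \<and> c \<in> homotopy_cells D n"
  unfolding globular_set.composable_def[OF globular_set_homotopy_cells]
  by (auto elim!: homotopy_cellsE simp: homotopy_group_simps dest: homotopy_group_inj)

theorem theorem3p1:
  fixes D :: "'a topology"
  shows "strict_infinity_groupoid (homotopy_cells D) (homotopy_source D) (homotopy_target D)
           (homotopy_comp D) (homotopy_idn D)"
  \<comment> \<open>On the diagonal every axiom becomes an equation between homotopy groups at one
    base point. Composability forces the inverse of a cell to be the cell itself.\<close>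
  unfolding strict_infinity_groupoid_def strict_infinity_groupoid_axioms_def composable_homotopy_cells
  by (auto elim!: homotopy_cellsE simp: globular_set_homotopy_cells homotopy_group_simps Bex_def
      intro: homotopy_group_in_cells)

end
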